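(* Let $u=(u_1,u_2,\ldots)$ be a sequence of nonnegative integers that is eventually zero, let $w=\sum_i iu_i$, $d=\sum_i u_i$, and $\nu(u)=\sum_i u_i\,\nu(i+1)$. Let $n$ be an integer with $w\le n$. Then $n-\nu(u)\ge n-w+(w-d)/2$, and $n-\nu(u)=(w-d)/2$ if and only if $n=w$ and $u_i=0$ for all $i\notin\{1,3\}$.
   Context: $\nu$ denotes the $2$-adic valuation of an integer. The sequence $u$ is regarded as a partition of $w$ in which $u_i$ is the multiplicity of the part $i$, and $d$ is the number of parts. *)

theory Defs
  imports Complex_Main "HOL-Computational_Algebra.Primes"
begin

text \<open>
  A sequence \<open>(u\<^sub>1, u\<^sub>2, \<dots>)\<close> is a function \<open>u :: nat \<Rightarrow> nat\<close> read at the indices \<open>i \<ge> 1\<close>;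
  the value \<open>u 0\<close> is not part of the sequence and is never used. Viewed as a partition,
  \<open>u i\<close> is the multiplicity of the part \<open>i\<close>. The sums below range over the parts that
  occur, a finite set when the sequence is eventually zero.
\<close>

definition parts :: "(nat \<Rightarrow> nat) \<Rightarrow> nat set" where
  "parts u = {i. 1 \<le> i \<and> u i \<noteq> 0}"

definition weight :: "(nat \<Rightarrow> nat) \<Rightarrow> nat" where
  "weight u = (\<Sum>i\<in>parts u. i * u i)"

definition num_parts :: "(nat \<Rightarrow> nat) \<Rightarrow> nat" where
  "num_parts u = (\<Sum>i\<in>parts u. u i)"

definition nu :: "(nat \<Rightarrow> nat) \<Rightarrow> nat" where
  "nu u = (\<Sum>i\<in>parts u. u i * multiplicity (2 :: nat) (i + 1))"

end

theory Submission
  imports Defs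
begin

text \<open>
  Since \<open>2\<^sup>k\<close> divides \<open>m\<close> for \<open>k = \<nu>(m)\<close>, we have \<open>2 \<nu>(m) \<le> 2\<^sup>k \<le> m\<close>, with equality
  exactly for \<open>m = 2\<close> and \<open>m = 4\<close>. Taking \<open>m = i + 1\<close> and summing with weights \<open>u\<^sub>i\<close> gives
  \<open>2 \<nu>(u) \<le> w + d\<close>, with equality iff only the parts \<open>1\<close> and \<open>3\<close> occur; both claims are
  rearrangements of this.
\<close>

text \<open>From exponent 3 on the estimate is strict, so equality can only come from the exponents
  0, 1 and 2.\<close>

lemma double_less_power_two:
  assumes "3 \<le> k"
  shows "2 * k < (2 :: nat) ^ k"
  using assms by (induction k rule: dec_induct) auto

lemma double_multiplicity_two:
  fixes m :: nat
  assumes "m > 0"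
  shows double_multiplicity_two_le: "2 * multiplicity 2 m \<le> m"
    and double_multiplicity_two_eq_iff: "2 * multiplicity 2 m = m \<longleftrightarrow> m = 2 \<or> m = 4"
proof -
  define k where "k = multiplicity 2 m"
  have pow: "2 ^ k \<le> m"
    unfolding k_def using assms by (intro dvd_imp_le multiplicity_dvd) auto
  \<comment> \<open>Equality is excluded by \<open>m > 0\<close> for \<open>k = 0\<close> and by
    strictness for \<open>3 \<le> k\<close>; the other two values give \<open>m = 2\<close> and
    \<open>m = 4\<close>.\<close>
  consider "k = 0" | "k = 1" | "k = 2" | "3 \<le> k"
    by linarith
  then have *: "2 * k \<le> m \<and> (2 * k = m \<longrightarrow> m = 2 \<or> m = 4)"
    using pow assms by cases (use double_less_power_two[of k] in auto)
  have "multiplicity 2 (2 :: nat) = 1"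
    by (rule multiplicity_self) auto
  moreover have "multiplicity 2 (2 ^ 2 :: nat) = 2"
    by (rule multiplicity_same_power) auto
  ultimately have "2 * multiplicity 2 m = m" if "m = 2 \<or> m = 4"
    using that by auto
  then show "2 * multiplicity 2 m \<le> m" "2 * multiplicity 2 m = m \<longleftrightarrow> m = 2 \<or> m = 4"
    using * unfolding k_def by blast+
qed

lemma finite_parts:
  assumes "\<forall>\<^sub>F i in sequentially. u i = 0"
  shows "finite (parts u)"
proof -
  obtain N where "\<And>i. i \<ge> N \<Longrightarrow> u i = 0"
    using assms by (auto simp: eventually_sequentially)
  then have "parts u \<subseteq> {..<N}"
    by (auto simp: parts_def intro: ccontr)
  then show ?thesis
    using finite_subset by blast
qed

lemma weight_add_num_parts: "weight u + num_parts u = (\<Sum>i\<in>parts u. u i * (i + 1))"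
  by (simp add: weight_def num_parts_def sum.distrib[symmetric] algebra_simps)

lemma double_nu: "2 * nu u = (\<Sum>i\<in>parts u. u i * (2 * multiplicity 2 (i + 1)))"
  by (simp add: nu_def sum_distrib_left mult.left_commute)

text \<open>The bound for a single part, applied to \<open>m = i + 1\<close>, is summed. Over an
  infinite \<open>parts u\<close> all the sums are 0 by convention.\<close>

lemma double_nu_le: "2 * nu u \<le> weight u + num_parts u"
  unfolding weight_add_num_parts double_nu
  by (intro sum_mono mult_left_mono double_multiplicity_two_le) auto

lemma double_nu_eq_iff:
  assumes "\<forall>\<^sub>F i in sequentially. u i = 0"
  shows "2 * nu u = weight u + num_parts u \<longleftrightarrow> (\<forall>i\<ge>1. i \<notin> {1, 3} \<longrightarrow> u i = 0)"
proof -
  have "2 * nu u = weight u + num_parts u \<longleftrightarrow>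
      (\<forall>i\<in>parts u. u i * (2 * multiplicity 2 (i + 1)) = u i * (i + 1))"
  proof
    assume eq: "2 * nu u = weight u + num_parts u"
    show "\<forall>i\<in>parts u. u i * (2 * multiplicity 2 (i + 1)) = u i * (i + 1)"
    proof
      fix i assume i: "i \<in> parts u"
      show "u i * (2 * multiplicity 2 (i + 1)) = u i * (i + 1)"
      \<comment> \<open>Each term on the left is at most its counterpart on the right, so over a
        finite set equal sums force equal terms.\<close>
      proof (rule sum_mono_inv[OF _ _ i finite_parts[OF assms]])
        show "(\<Sum>i\<in>parts u. u i * (2 * multiplicity 2 (i + 1))) = (\<Sum>i\<in>parts u. u i * (i + 1))"
          using eq unfolding weight_add_num_parts double_nu .
      qed (intro mult_left_mono double_multiplicity_two_le, auto)
    qed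
  next
    assume "\<forall>i\<in>parts u. u i * (2 * multiplicity 2 (i + 1)) = u i * (i + 1)"
    then show "2 * nu u = weight u + num_parts u"
      unfolding weight_add_num_parts double_nu by (intro sum.cong) auto
  qed
  \<comment> \<open>The factor \<open>u i\<close> cancels, being nonzero on
    \<open>parts u\<close>.\<close>
  also have "\<dots> \<longleftrightarrow> (\<forall>i\<in>parts u. i + 1 = 2 \<or> i + 1 = 4)"
    by (intro ball_cong refl, subst mult_cancel1)
      (simp add: parts_def double_multiplicity_two_eq_iff del: One_nat_def add_Suc_right Suc_eq_plus1)
  also have "\<dots> \<longleftrightarrow> (\<forall>i\<ge>1. i \<notin> {1, 3} \<longrightarrow> u i = 0)"
    by (auto simp: parts_def)
  finally show ?thesis .
qed

theorem theorem6p1: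
  fixes u :: "nat \<Rightarrow> nat" and w d :: nat and n :: int
  assumes "\<forall>\<^sub>F i in sequentially. u i = 0"
    and "w = weight u"
    and "d = num_parts u"
    and "int w \<le> n"
  shows "real_of_int n - real (nu u) \<ge> (real_of_int n - real w) + (real w - real d) / 2 \<and>
    (real_of_int n - real (nu u) = (real w - real d) / 2 \<longleftrightarrow>
       n = int w \<and> (\<forall>i\<ge>1. i \<notin> {1, 3} \<longrightarrow> u i = 0))"
proof -
  have le: "2 * nu u \<le> w + d"
    using double_nu_le assms(2,3) by simp
  then have "2 * real (nu u) \<le> real w + real d"
    by linarith
  then have bound: "real_of_int n - real (nu u) \<ge> (real_of_int n - real w) + (real w - real d) / 2"
    by (simp add: field_simps)
  \<comment> \<open>Doubling clears the fraction, so that the equation can be read over the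
    integers.\<close>
  have "real_of_int n - real (nu u) = (real w - real d) / 2 \<longleftrightarrow>
      real_of_int (2 * n - 2 * int (nu u)) = real_of_int (int w - int d)"
    by (simp add: field_simps)
  also have "\<dots> \<longleftrightarrow> 2 * n - 2 * int (nu u) = int w - int d"
    by (rule of_int_eq_iff)
  \<comment> \<open>The equation says \<open>2 * (n - w) + (w + d - 2 * nu u) = 0\<close>; both
    summands are nonnegative, so both vanish.\<close>
  also have "\<dots> \<longleftrightarrow> n = int w \<and> 2 * nu u = w + d"
    using le assms(4) by linarith
  finally show ?thesis
    using bound double_nu_eq_iff[OF assms(1)] assms(2,3) by simp
qed

end
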